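(* Let $k>0$, $c>0$, $\nu>0$ and $\alpha\in[0,1)$. Then the following assertions are true. (a) The radius of starlikeness of order $\alpha$ of the function ${}_{k}f_{\nu,c}$ is the smallest positive root of the equation $$kr\,{}_{k}W_{\nu,c}'(r)-\nu\alpha\,{}_{k}W_{\nu,c}(r)=0.$$ (b) The radius of starlikeness of order $\alpha$ of the function ${}_{k}g_{\nu,c}$ is the smallest positive root of the equation $$r\,{}_{k}W_{\nu,c}'(r)-\left(\alpha+\frac{\nu}{k}-1\right){}_{k}W_{\nu,c}(r)=0.$$ (c) The radius of starlikeness of order $\alpha$ of the function ${}_{k}h_{\nu,c}$ is the smallest positive root of the equation $$\sqrt{r}\,{}_{k}W_{\nu,c}'(\sqrt{r})-2\left(\alpha+\frac{\nu}{2k}-1\right){}_{k}W_{\nu,c}(\sqrt{r})=0.$$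
   Context: For $k>0$ the $k$-gamma function is $\Gamma_{k}(z)=\int_{0}^{\infty}t^{z-1}e^{-t^{k}/k}\,dt$ for $\operatorname{Re}(z)>0$; equivalently $\Gamma_k(z)=k^{\frac{z}{k}-1}\Gamma\left(\frac{z}{k}\right)$. The generalized $k$-Bessel function of order $\nu$ is $${}_{k}W_{\nu,c}(z)=\sum_{n=0}^{\infty}\frac{(-c)^n}{n!\,\Gamma_{k}(nk+\nu+k)}\left(\frac{z}{2}\right)^{2n+\frac{\nu}{k}}.$$ Its normalized forms are $${}_{k}f_{\nu,c}(z)=\left(2^{\frac{\nu}{k}}\Gamma_{k}(\nu+k)\,{}_{k}W_{\nu,c}(z)\right)^{\frac{k}{\nu}},\quad {}_{k}g_{\nu,c}(z)=2^{\frac{\nu}{k}}\Gamma_{k}(\nu+k)z^{1-\frac{\nu}{k}}{}_{k}W_{\nu,c}(z),\quad {}_{k}h_{\nu,c}(z)=2^{\frac{\nu}{k}}\Gamma_{k}(\nu+k)z^{1-\frac{\nu}{2k}}{}_{k}W_{\nu,c}(\sqrt{z}).$$ Multivalued functions are taken with the principal branch, so that each of these three functions is analytic near $0$ with value $0$ and derivative $1$ at $0$. Explicitly, with the entire function $w(z)=\Gamma_k(\nu+k)\sum_{n\ge0}\frac{(-c)^n}{n!\,\Gamma_k(nk+\nu+k)}\left(\frac{z}{2}\right)^{2n}$, $w(0)=1$, one has ${}_{k}g_{\nu,c}(z)=z\,w(z)$, ${}_{k}h_{\nu,c}(z)=z\,w(\sqrt z)$ (both entire), and ${}_{k}f_{\nu,c}(z)=z\,w(z)^{k/\nu}$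 with the analytic branch of the power equal to $1$ at $z=0$, in the largest disk centered at $0$ where $w$ has no zeros. Let $\mathbb{D}_r=\{z\in\mathbb{C}:|z|<r\}$. For $f$ analytic near $0$ with $f(0)=f'(0)-1=0$, the radius of starlikeness of order $\alpha$ is $$r_{\alpha}^{\star}(f)=\sup\left\{r>0:\ \operatorname{Re}\left(\frac{zf'(z)}{f(z)}\right)>\alpha\ \text{for all } z\in\mathbb{D}_r\right\},$$ where $r$ ranges over values not exceeding the radius of convergence of the Taylor series of $f$ at $0$. *)

theory Defs
  imports "HOL-Complex_Analysis.Complex_Analysis"
begin

definition k_Gamma :: "real \<Rightarrow> complex \<Rightarrow> complex" where
  "k_Gamma k z = integral {0<..} (\<lambda>t. of_real t powr (z - 1) * of_real (exp (- (t powr k) / k)))"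

definition k_Bessel_W :: "real \<Rightarrow> real \<Rightarrow> real \<Rightarrow> complex \<Rightarrow> complex" where
  "k_Bessel_W k \<nu> c z =
     (\<Sum>n. (- of_real c) ^ n / (fact n * k_Gamma k (of_real (real n * k + \<nu> + k)))
           * (z / 2) powr of_real (2 * real n + \<nu> / k))"

text \<open>
  Principal powers and \<open>csqrt\<close> satisfy \<open>z powr (1 - a) * (z / 2) powr (2 * n + a) = z * (z / 2) ^ (2 * n) / 2 powr a\<close>
  and its analogue with \<open>csqrt z\<close> on the whole punctured plane, while \<open>0 powr a = 0\<close>.  Hence the
  literal formulas below define the entire functions \<open>z * w z\<close> and \<open>z * w (csqrt z)\<close>, where \<open>w\<close> is
  \<open>k_Bessel_w k \<nu> c\<close>, also along the negative real axis and at the origin.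
\<close>

definition k_Bessel_g :: "real \<Rightarrow> real \<Rightarrow> real \<Rightarrow> complex \<Rightarrow> complex" where
  "k_Bessel_g k \<nu> c z =
     2 powr of_real (\<nu> / k) * k_Gamma k (of_real (\<nu> + k)) * z powr of_real (1 - \<nu> / k)
       * k_Bessel_W k \<nu> c z"

definition k_Bessel_h :: "real \<Rightarrow> real \<Rightarrow> real \<Rightarrow> complex \<Rightarrow> complex" where
  "k_Bessel_h k \<nu> c z =
     2 powr of_real (\<nu> / k) * k_Gamma k (of_real (\<nu> + k)) * z powr of_real (1 - \<nu> / (2 * k))
       * k_Bessel_W k \<nu> c (csqrt z)"

definition k_Bessel_w :: "real \<Rightarrow> real \<Rightarrow> real \<Rightarrow> complex \<Rightarrow> complex" where
  "k_Bessel_w k \<nu> c z =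
     k_Gamma k (of_real (\<nu> + k)) *
     (\<Sum>n. (- of_real c) ^ n / (fact n * k_Gamma k (of_real (real n * k + \<nu> + k)))
           * (z / 2) ^ (2 * n))"

text \<open>The largest open disk centred at \<open>0\<close> (possibly empty or the whole plane) on which \<open>w\<close> has no zeros.\<close>

definition zero_free_disk :: "(complex \<Rightarrow> complex) \<Rightarrow> complex set" where
  "zero_free_disk w = \<Union> {ball 0 r | r. \<forall>z \<in> ball 0 r. w z \<noteq> 0}"

text \<open>
  If \<open>w\<close> is entire with \<open>w 0 = 1\<close>, the disk is convex and contains \<open>0\<close>, so an analytic logarithm
  vanishing at \<open>0\<close> exists and is unique on the disk; its values off the disk are unspecified.
\<close>

definition log_branch :: "(complex \<Rightarrow> complex) \<Rightarrow> complex \<Rightarrow> complex" where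
  "log_branch w = (SOME L. L holomorphic_on zero_free_disk w \<and> L 0 = 0 \<and>
                           (\<forall>z \<in> zero_free_disk w. exp (L z) = w z))"

text \<open>
  The power \<open>(2 powr (\<nu> / k) * \<Gamma> * W z) powr (k / \<nu>)\<close> is \<open>z * w z powr (k / \<nu>)\<close>, with the branch of the
  power that is analytic on the zero-free disk of \<open>w\<close> and equal to \<open>1\<close> at the origin.  Applying the
  principal power to the whole expression would in general not be analytic near \<open>0\<close>.
\<close>

definition k_Bessel_f :: "real \<Rightarrow> real \<Rightarrow> real \<Rightarrow> complex \<Rightarrow> complex" where
  "k_Bessel_f k \<nu> c z = z * exp (of_real (k / \<nu>) * log_branch (k_Bessel_w k \<nu> c) z)"

text \<open>
  For \<open>f 0 = 0\<close> and \<open>deriv f 0 = 1\<close> the quotient \<open>z * deriv f z / f z\<close> has a removable singularity at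
  \<open>0\<close> with value \<open>1\<close>; Isabelle's \<open>0 / 0 = 0\<close> would give the wrong value there.
\<close>

definition starlike_quotient :: "(complex \<Rightarrow> complex) \<Rightarrow> complex \<Rightarrow> complex" where
  "starlike_quotient f z = (if z = 0 then 1 else z * deriv f z / f z)"

text \<open>The supremum is taken in the extended reals, so that it is meaningful for unbounded sets as well.\<close>

definition radius_of_starlikeness :: "real \<Rightarrow> (complex \<Rightarrow> complex) \<Rightarrow> ereal" where
  "radius_of_starlikeness \<alpha> f =
     Sup {ereal r | r. 0 < r \<and> ereal r \<le> fps_conv_radius (fps_expansion f 0) \<and>
                       (\<forall>z \<in> ball 0 r. Re (starlike_quotient f z) > \<alpha>)}"

definition is_smallest_positive_root :: "(real \<Rightarrow> complex) \<Rightarrow> real \<Rightarrow> bool" where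
  "is_smallest_positive_root F r \<longleftrightarrow>
     0 < r \<and> F r = 0 \<and> (\<forall>s. 0 < s \<and> F s = 0 \<longrightarrow> r \<le> s)"

end

theory Submission
  imports Defs
begin

text \<open>
  Put \<open>a = \<nu> / k\<close>, \<open>q = c / (4 * k)\<close>, and let \<open>\<Phi>\<close> be the entire function
  \<open>\<Phi> u = (\<Sum>n. (- u) ^ n / (n! * (a + 1) (a + 2) \<dots> (a + n)))\<close>.  Since
  \<open>\<Gamma>\<^sub>k(x) = k powr (x / k - 1) * Gamma (x / k)\<close>, the function \<open>w\<close> is \<open>\<Phi> (q * z\<^sup>2)\<close>.  With
  \<open>H = - \<Phi>' / \<Phi>\<close>, each of the three quotients \<open>z * f' z / f z\<close> has the form
  \<open>1 - b * (u * H u)\<close>, where \<open>u = q * z\<^sup>2\<close> and \<open>b = 2 * k / \<nu>\<close> for \<open>f\<close>, \<open>u = q * z\<^sup>2\<close> and \<open>b = 2\<close> for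
  \<open>g\<close>, \<open>u = q * z\<close> and \<open>b = 1\<close> for \<open>h\<close>.  The function of \<open>r\<close> whose roots are sought is
  \<open>1 - \<alpha> - b * (u * H u)\<close> at \<open>z = r\<close>, times a factor without zeros in the range that matters.

  Everything rests on one fact: the Taylor coefficients of \<open>H\<close> at \<open>0\<close> are nonnegative.
  (They are the Rayleigh sums, the power sums of the reciprocals of the zeros of \<open>\<Phi>\<close>, which are
  real and positive.)  The reason used here is algebraic: the differential equation
  \<open>u * \<Phi>'' + (a + 1) * \<Phi>' + \<Phi> = 0\<close> turns into the Riccati equation
  \<open>u * H' + (a + 1) * H = 1 + u * H\<^sup>2\<close>, which expresses \<open>(n + a + 1)\<close> times the \<open>n\<close>-th
  coefficient, for \<open>n > 0\<close>, as a sum of products of earlier ones (\<open>clifford_riccati\<close>, \<open>riccati_nonneg\<close>).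

  Let \<open>R\<close> be the radius of convergence of \<open>H\<close>.  For \<open>norm u < R\<close>, nonnegativity gives
  \<open>Re (u * H u) \<le> norm u * H (norm u)\<close>, with equality for \<open>u\<close> on the positive axis, where
  \<open>t * H t\<close> is strictly increasing.  So if \<open>t < R\<close> solves \<open>t * H t = (1 - \<alpha>) / b\<close>, the
  corresponding radius \<open>\<rho>\<close> is both the smallest root and the radius of starlikeness
  (\<open>radius_of_starlikeness_eq_root\<close>).  A solution exists because \<open>t * H t\<close> is unbounded on
  \<open>(0, R)\<close>: this is clear if \<open>R = \<infinity>\<close>, and otherwise boundedness of \<open>H\<close> would keep
  \<open>\<Phi> = exp (- \<integral> H)\<close> away from \<open>0\<close> on the disk of radius \<open>R\<close>, so that \<open>H\<close> would be analytic on a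
  larger disk (\<open>times_neg_ld_unbounded\<close>).
\<close>

section \<open>Entire functions whose negative logarithmic derivative has nonnegative coefficients\<close>

locale positive_log_derivative =
  fixes F :: "complex fps"
  assumes entire: "fps_conv_radius F = \<infinity>"
    and at_zero: "fps_nth F 0 = 1"
    and nonneg: "\<And>n. fps_nth (- fps_deriv F * inverse F) n \<in> \<real>\<^sub>\<ge>\<^sub>0"
    and nonconst: "fps_nth F 1 \<noteq> 0"
begin

text \<open>
  The function \<open>H = - F' / F\<close> of the introduction as a formal power series.  Its radius of
  convergence \<open>neg_ld_radius\<close> is the modulus of the smallest zero of \<open>F\<close>, or infinite.
\<close>

definition neg_ld :: "complex fps" where
  "neg_ld = - fps_deriv F * inverse F"

definition neg_ld_radius :: ereal where
  "neg_ld_radius = fps_conv_radius neg_ld"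

lemma fps_deriv_F: "fps_deriv F = - neg_ld * F"
  using at_zero inverse_mult_eq_1'[of F] by (simp add: neg_ld_def mult.assoc inverse_mult_eq_1)

text \<open>
  The quotient \<open>- F' / F\<close> is analytic wherever \<open>F\<close> has no zeros, and a power series converges on
  every disk to which its sum extends analytically.
\<close>

lemma neg_ld_radius_ge:
  assumes "r > 0" and nz: "\<And>z. norm z < r \<Longrightarrow> eval_fps F z \<noteq> 0"
  shows "ereal r \<le> neg_ld_radius"
proof -
  have F: "eval_fps F has_fps_expansion F"
    using entire by (simp add: has_fps_expansion_def)
  have "(\<lambda>z. - deriv (eval_fps F) z * inverse (eval_fps F z)) has_fps_expansion neg_ld"
    unfolding neg_ld_def by (intro fps_expansion_intros F) (use at_zero in auto)
  hence "fps_expansion (\<lambda>z. - deriv (eval_fps F) z * inverse (eval_fps F z)) 0 = neg_ld"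
    by (rule fps_expansion_eqI)
  moreover have hol: "(\<lambda>z. - deriv (eval_fps F) z * inverse (eval_fps F z)) holomorphic_on eball 0 (ereal r)"
    using nz entire by (intro holomorphic_intros) (auto intro!: holomorphic_on_eval_fps)
  ultimately show ?thesis
    using conv_radius_fps_expansion[OF hol] by (simp add: neg_ld_radius_def)
qed

lemma neg_ld_radius_pos: "neg_ld_radius > 0"
proof -
  have "isCont (eval_fps F) 0"
    using entire by (intro continuous_eval_fps) auto
  then obtain e where e: "e > 0" "\<forall>z. dist z 0 < e \<longrightarrow> dist (eval_fps F z) (eval_fps F 0) < 1"
    unfolding continuous_at_eps_delta using zero_less_one by blast
  have "eval_fps F z \<noteq> 0" if "norm z < e" for z
  proof
    assume "eval_fps F z = 0"
    moreover have "dist (eval_fps F z) (eval_fps F 0) < 1" using e(2) that by simp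
    ultimately show False using at_zero by (simp add: eval_fps_at_0)
  qed
  hence "ereal e \<le> neg_ld_radius" using e(1) by (intro neg_ld_radius_ge)
  moreover have "0 < ereal e" using e(1) by simp
  ultimately show ?thesis by (rule less_le_trans[rotated])
qed

lemma has_derivative_F:
  assumes "norm z < neg_ld_radius"
  shows "(eval_fps F has_field_derivative - eval_fps neg_ld z * eval_fps F z) (at z within S)"
proof -
  have "eval_fps (fps_deriv F) z = - eval_fps neg_ld z * eval_fps F z"
    using assms entire unfolding fps_deriv_F neg_ld_radius_def
    by (subst eval_fps_mult) (auto simp: eval_fps_minus)
  thus ?thesis
    using has_field_derivative_eval_fps[of z F S] entire by simp
qed

text \<open>
  If \<open>L\<close> is a primitive of \<open>- F' / F\<close>, then \<open>F * exp L\<close> has derivative \<open>0\<close>, so that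
  \<open>F z = exp (L 0 - L z)\<close>; and \<open>L\<close> is Lipschitz with constant \<open>B\<close>.  In particular \<open>F\<close> has no
  zeros where \<open>- F' / F\<close>, as a power series, converges.
\<close>

lemma lower_bound:
  assumes "ereal r \<le> neg_ld_radius" and B: "\<And>z. norm z < r \<Longrightarrow> norm (eval_fps neg_ld z) \<le> B"
    and z: "norm z < r"
  shows "exp (- (B * norm z)) \<le> norm (eval_fps F z)"
proof -
  have in_R: "ereal (norm x) < neg_ld_radius" if "norm x < r" for x :: complex
    using that assms(1) by (meson less_ereal.simps(1) less_le_trans)
  have r: "r > 0" using z norm_ge_zero[of z] by linarith
  have "eval_fps neg_ld holomorphic_on ball 0 r"
    using in_R by (intro holomorphic_on_eval_fps) (auto simp: neg_ld_radius_def)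
  then obtain L where L: "\<And>x. x \<in> ball 0 r \<Longrightarrow> (L has_field_derivative eval_fps neg_ld x) (at x within ball 0 r)"
    using holomorphic_convex_primitive'[OF convex_ball open_ball] by blast
  hence "norm (L z - L 0) \<le> B * norm (z - 0)"
    using z r B by (intro field_differentiable_bound[of "ball 0 r" L "eval_fps neg_ld"]) auto
  moreover have "Re (L z - L 0) \<le> norm (L z - L 0)"
    by (rule complex_Re_le_cmod)
  ultimately have le: "- (B * norm z) \<le> Re (L 0 - L z)" by simp
  have "\<exists>c. \<forall>x\<in>ball 0 r. eval_fps F x * exp (L x) = c"
  proof (rule has_field_derivative_zero_constant)
    fix x :: complex assume x: "x \<in> ball 0 r"
    show "((\<lambda>x. eval_fps F x * exp (L x)) has_field_derivative 0) (at x within ball 0 r)"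
      using DERIV_mult[OF has_derivative_F DERIV_chain2[OF DERIV_exp L]] x in_R[of x]
      by (simp add: algebra_simps)
  qed auto
  hence "eval_fps F z * exp (L z) = eval_fps F 0 * exp (L 0)"
    using z r by auto
  hence "eval_fps F z = exp (L 0 - L z)"
    using at_zero by (simp add: eval_fps_at_0 exp_diff field_simps)
  thus ?thesis using le by simp
qed

lemma F_nonzero:
  assumes "norm z < neg_ld_radius"
  shows "eval_fps F z \<noteq> 0"
proof -
  obtain r where r: "norm z < r" "ereal r < neg_ld_radius"
    using assms ereal_dense2 by (metis less_ereal.simps(1))
  have "compact (eval_fps neg_ld ` cball 0 r)"
    using r(2) by (intro compact_continuous_image continuous_on_eval_fps')
      (auto simp: neg_ld_radius_def intro: le_less_trans[OF ereal_less_eq(3)[THEN iffD2]])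
  then obtain B where "\<And>x. norm x \<le> r \<Longrightarrow> norm (eval_fps neg_ld x) \<le> B"
    by (force dest!: compact_imp_bounded simp: bounded_iff)
  hence "exp (- (B * norm z)) \<le> norm (eval_fps F z)"
    using r by (intro lower_bound[of r]) auto
  thus ?thesis using exp_gt_zero[of "- (B * norm z)"] by (metis norm_zero not_le)
qed

text \<open>
  The restriction of the sum of \<open>neg_ld\<close> to the real axis, where it is real-valued.
\<close>

definition neg_ld_real :: "real \<Rightarrow> real" where
  "neg_ld_real t = Re (eval_fps neg_ld (of_real t))"

lemma neg_ld_nth: "fps_nth neg_ld n = of_real (Re (fps_nth neg_ld n))" "Re (fps_nth neg_ld n) \<ge> 0"
  using nonneg[of n, folded neg_ld_def] by (auto simp: complex_nonneg_Reals_iff complex_eq_iff)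

lemma neg_ld_0_pos: "Re (fps_nth neg_ld 0) > 0"
proof -
  have "fps_nth (fps_deriv F) 0 = - fps_nth neg_ld 0"
    using at_zero by (simp add: fps_deriv_F)
  hence "fps_nth neg_ld 0 \<noteq> 0" using nonconst by auto
  thus ?thesis using neg_ld_nth[of 0] by (metis less_eq_real_def of_real_0)
qed

lemma neg_ld_real_sums:
  assumes "ereal \<bar>t\<bar> < neg_ld_radius"
  shows "(\<lambda>n. Re (fps_nth neg_ld n) * t ^ n) sums neg_ld_real t"
    and "eval_fps neg_ld (of_real t) = of_real (neg_ld_real t)"
proof -
  have "(\<lambda>n. fps_nth neg_ld n * of_real t ^ n) sums eval_fps neg_ld (of_real t)"
    using assms by (intro sums_eval_fps) (simp add: neg_ld_radius_def)
  moreover have eq: "fps_nth neg_ld n * of_real t ^ n = of_real (Re (fps_nth neg_ld n) * t ^ n)" for n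
    by (subst neg_ld_nth(1)) simp
  ultimately have *: "(\<lambda>n. complex_of_real (Re (fps_nth neg_ld n) * t ^ n)) sums eval_fps neg_ld (of_real t)"
    by simp
  from sums_Re[OF *] show 1: "(\<lambda>n. Re (fps_nth neg_ld n) * t ^ n) sums neg_ld_real t"
    by (simp add: neg_ld_real_def)
  show "eval_fps neg_ld (of_real t) = of_real (neg_ld_real t)"
    using sums_unique2[OF * sums_of_real[OF 1]] .
qed

lemma norm_neg_ld_le:
  assumes "norm z < neg_ld_radius"
  shows "norm (eval_fps neg_ld z) \<le> neg_ld_real (norm z)"
proof -
  have "norm (fps_nth neg_ld n * z ^ n) = Re (fps_nth neg_ld n) * norm z ^ n" for n
    using neg_ld_nth[of n] by (metis norm_mult norm_of_real norm_power abs_of_nonneg)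
  hence "(\<lambda>n. norm (fps_nth neg_ld n * z ^ n)) sums neg_ld_real (norm z)"
    using neg_ld_real_sums(1)[of "norm z"] assms by simp
  moreover have "eval_fps neg_ld z = (\<Sum>n. fps_nth neg_ld n * z ^ n)" by (simp add: eval_fps_def)
  ultimately show ?thesis
    using summable_norm[of "\<lambda>n. fps_nth neg_ld n * z ^ n"] by (simp add: sums_iff)
qed

lemma neg_ld_real_mono:
  assumes "0 \<le> s" "s \<le> t" "ereal t < neg_ld_radius"
  shows "neg_ld_real s \<le> neg_ld_real t"
proof (rule sums_le)
  have "ereal s < neg_ld_radius" using assms by (meson ereal_less_eq(3) le_less_trans)
  thus "(\<lambda>n. Re (fps_nth neg_ld n) * s ^ n) sums neg_ld_real s" using assms by (intro neg_ld_real_sums) auto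
  show "(\<lambda>n. Re (fps_nth neg_ld n) * t ^ n) sums neg_ld_real t" using assms by (intro neg_ld_real_sums) auto
qed (use assms neg_ld_nth in \<open>auto intro!: mult_left_mono power_mono\<close>)

lemma neg_ld_real_pos:
  assumes "0 \<le> t" "ereal t < neg_ld_radius"
  shows "0 < neg_ld_real t" "neg_ld_real 0 \<le> neg_ld_real t"
proof -
  have "neg_ld_real 0 = Re (fps_nth neg_ld 0)" by (simp add: neg_ld_real_def eval_fps_at_0)
  moreover show "neg_ld_real 0 \<le> neg_ld_real t" using assms by (intro neg_ld_real_mono) auto
  ultimately show "0 < neg_ld_real t" using neg_ld_0_pos by linarith
qed

lemma times_neg_ld_strict_mono:
  assumes "0 \<le> s" "s < t" "ereal t < neg_ld_radius"
  shows "s * neg_ld_real s < t * neg_ld_real t"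
proof -
  have "s * neg_ld_real s \<le> s * neg_ld_real t" using assms by (intro mult_left_mono neg_ld_real_mono) auto
  also have "\<dots> < t * neg_ld_real t" using assms neg_ld_real_pos(1)[of t] by simp
  finally show ?thesis .
qed

text \<open>
  Suppose \<open>t * H t < T\<close> throughout.  Because \<open>H 0 > 0\<close> this makes the radius of convergence a
  finite number \<open>r\<close>, and it bounds \<open>H\<close> on the whole disk by nonnegativity of the coefficients.  Then \<open>F\<close> is
  bounded below on the closed disk, hence without zeros on a slightly larger one, on which \<open>H\<close> would
  converge.
\<close>

lemma times_neg_ld_unbounded:
  assumes "T > 0"
  shows "\<exists>t>0. ereal t < neg_ld_radius \<and> T \<le> t * neg_ld_real t"
proof (rule ccontr)
  assume "\<not> ?thesis"
  hence less: "t * neg_ld_real t < T" if "t > 0" "ereal t < neg_ld_radius" for t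
    using that by force
  have y0: "neg_ld_real 0 > 0" using neg_ld_real_pos(1)[of 0] neg_ld_radius_pos by (simp add: zero_ereal_def)
  have "neg_ld_radius \<le> ereal (T / neg_ld_real 0)"
  proof (rule ccontr)
    assume "\<not> ?thesis"
    hence lt: "ereal (T / neg_ld_real 0) < neg_ld_radius" by simp
    have "T / neg_ld_real 0 * neg_ld_real 0 \<le> T / neg_ld_real 0 * neg_ld_real (T / neg_ld_real 0)"
      using lt y0 assms by (intro mult_left_mono neg_ld_real_pos(2)) auto
    thus False using less[of "T / neg_ld_real 0"] lt y0 assms by simp
  qed
  then obtain r where r: "neg_ld_radius = ereal r" "r > 0"
    using neg_ld_radius_pos by (cases neg_ld_radius) auto
  \<comment> \<open>Near \<open>0\<close> monotonicity bounds \<open>H\<close>; for \<open>t > r / 2\<close> the assumption does, as \<open>H t < T / t\<close>.\<close>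
  define B where "B = neg_ld_real (r / 2) + 2 * T / r"
  have yB: "neg_ld_real t \<le> B" if "0 \<le> t" "t < r" for t
  proof (cases "t \<le> r / 2")
    case True
    hence "neg_ld_real t \<le> neg_ld_real (r / 2)" using that r by (intro neg_ld_real_mono) auto
    thus ?thesis using r assms by (simp add: B_def add_increasing2)
  next
    case False
    hence "neg_ld_real t < T / t" using less[of t] that r by (simp add: field_simps)
    also have "\<dots> \<le> T / (r / 2)" using False r assms by (intro divide_left_mono) auto
    finally have "neg_ld_real t \<le> 2 * T / r" by (simp add: mult.commute)
    moreover have "0 < neg_ld_real (r / 2)" using r by (intro neg_ld_real_pos(1)) auto
    ultimately show ?thesis unfolding B_def by linarith
  qed
  have YB: "norm (eval_fps neg_ld z) \<le> B" if "norm z < r" for z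
    using norm_neg_ld_le[of z] yB[of "norm z"] that r by simp
  have B0: "B \<ge> 0" using yB[of 0] y0 r by simp
  have inball: "exp (- (B * r)) \<le> norm (eval_fps F z)" if "z \<in> ball 0 r" for z
  proof -
    have "exp (- (B * r)) \<le> exp (- (B * norm z))"
      using that B0 by (simp add: mult_left_mono)
    also have "\<dots> \<le> norm (eval_fps F z)" using that r YB by (intro lower_bound[of r]) auto
    finally show ?thesis .
  qed
  have cont: "continuous_on UNIV (eval_fps F)"
    using entire by (intro continuous_on_eval_fps') auto
  have "closed {z. exp (- (B * r)) \<le> norm (eval_fps F z)}"
    by (intro closed_Collect_le continuous_intros cont)
  hence "closure (ball 0 r) \<subseteq> {z. exp (- (B * r)) \<le> norm (eval_fps F z)}"
    using inball by (intro closure_minimal) auto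
  hence "cball 0 r \<subseteq> {z. exp (- (B * r)) \<le> norm (eval_fps F z)}"
    using r by simp
  hence sub: "cball 0 r \<subseteq> {z. eval_fps F z \<noteq> 0}"
    using exp_gt_zero[of "- (B * r)"] by (auto simp del: exp_gt_zero)
  have "open {z. eval_fps F z \<noteq> 0}"
    by (intro open_Collect_neq cont continuous_intros)
  then obtain e where e: "e > 0" "(\<Union>x\<in>cball 0 r. ball x e) \<subseteq> {z. eval_fps F z \<noteq> 0}"
    using compact_subset_open_imp_ball_epsilon_subset[OF compact_cball _ sub] by metis
  have "eval_fps F z \<noteq> 0" if z: "norm z < r + e" for z
  proof -
    have "\<exists>x\<in>cball 0 r. z \<in> ball x e"
    proof (cases "norm z \<le> r")
      case True
      thus ?thesis using e by (intro bexI[of _ z]) auto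
    next
      case False
      \<comment> \<open>The radial projection of \<open>z\<close> to the closed disk of radius \<open>r\<close>.\<close>
      let ?x = "of_real (r / norm z) * z"
      have "z - ?x = of_real (1 - r / norm z) * z" by (simp add: algebra_simps)
      hence "norm (z - ?x) = \<bar>1 - r / norm z\<bar> * norm z" by (simp only: norm_mult norm_of_real)
      also have "\<dots> = norm z - r"
      proof -
        have "0 < norm z" using False r by linarith
        thus ?thesis using False by (subst abs_of_nonneg) (auto simp: field_simps)
      qed
      finally have "norm (z - ?x) = norm z - r" .
      moreover have "norm ?x = r"
      proof -
        have "z \<noteq> 0" using False r by auto
        thus ?thesis using r by (simp add: norm_mult norm_divide)
      qed
      ultimately show ?thesis using z by (intro bexI[of _ ?x]) (auto simp: dist_norm norm_minus_commute)
    qed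
    hence "z \<in> (\<Union>x\<in>cball 0 r. ball x e)" by blast
    thus ?thesis using e(2) by blast
  qed
  hence "ereal (r + e) \<le> neg_ld_radius" using r e by (intro neg_ld_radius_ge) auto
  thus False using r e by simp
qed

lemma times_neg_ld_attains:
  assumes "T > 0"
  obtains t where "t > 0" "ereal t < neg_ld_radius" "t * neg_ld_real t = T"
proof -
  obtain t1 where t1: "t1 > 0" "ereal t1 < neg_ld_radius" "T \<le> t1 * neg_ld_real t1"
    using times_neg_ld_unbounded[OF assms] by auto
  have inR: "ereal t < neg_ld_radius" if "t \<le> t1" for t
    using that t1 by (meson ereal_less_eq(3) le_less_trans)
  have "continuous_on {0..t1} (\<lambda>t. eval_fps neg_ld (of_real t))"
    using inR by (intro continuous_on_eval_fps' continuous_intros) (auto simp: neg_ld_radius_def dist_norm)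
  hence "continuous_on {0..t1} (\<lambda>t. t * neg_ld_real t)"
    unfolding neg_ld_real_def by (intro continuous_on_mult continuous_on_id continuous_on_Re)
  then obtain t where t: "0 \<le> t" "t \<le> t1" "t * neg_ld_real t = T"
    using IVT'[of "\<lambda>t. t * neg_ld_real t" 0 T t1] t1 assms by auto
  moreover from this assms have "t \<noteq> 0" by auto
  ultimately show ?thesis using inR[of t] by (intro that[of t]) auto
qed

section \<open>Radius of starlikeness and smallest root\<close>

text \<open>
  The three parts of the theorem are instances of this lemma: \<open>m\<close> is \<open>2\<close> for \<open>f\<close> and \<open>g\<close>, and \<open>1\<close>
  for \<open>h\<close>.  The bound \<open>Re (u * H u) \<le> norm u * H (norm u)\<close> shows that the disk of radius
  \<open>\<rho>\<close> is admissible; the point \<open>\<rho>\<close> itself, where the real part equals \<open>\<alpha>\<close>, excludes every larger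
  disk.
\<close>

lemma radius_of_starlikeness_eq_root:
  fixes G :: "real \<Rightarrow> complex" and q b \<alpha> :: real and m :: nat
  assumes "\<alpha> < 1" "b > 0" "q > 0" "m > 0"
    and hol: "\<And>r. r > 0 \<Longrightarrow> ereal (q * r ^ m) < neg_ld_radius \<Longrightarrow> f holomorphic_on ball 0 r"
    and quot: "\<And>z. z \<noteq> 0 \<Longrightarrow> ereal (q * norm z ^ m) < neg_ld_radius \<Longrightarrow>
      z * deriv f z / f z = 1 - of_real b * (of_real q * z ^ m * eval_fps neg_ld (of_real q * z ^ m))"
    and eqn: "\<And>r. r > 0 \<Longrightarrow> ereal (q * r ^ m) < neg_ld_radius \<Longrightarrow>
      \<exists>N. N \<noteq> 0 \<and> G r = N * of_real (1 - \<alpha> - b * (q * r ^ m * neg_ld_real (q * r ^ m)))"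
  shows "\<exists>\<rho>. is_smallest_positive_root G \<rho> \<and> radius_of_starlikeness \<alpha> f = ereal \<rho>"
proof -
  obtain t where t: "t > 0" "ereal t < neg_ld_radius" "t * neg_ld_real t = (1 - \<alpha>) / b"
    using times_neg_ld_attains[of "(1 - \<alpha>) / b"] assms by auto
  define \<rho> where "\<rho> = root m (t / q)"
  have \<rho>: "\<rho> > 0" "q * \<rho> ^ m = t"
    using t assms by (auto simp: \<rho>_def)
  have below: "q * s ^ m < t" if "0 \<le> s" "s < \<rho>" for s
    using that assms \<rho> power_strict_mono[of s \<rho> m] by force
  have belowR: "ereal (q * s ^ m) < neg_ld_radius" if "0 \<le> s" "s < \<rho>" for s
    using below[OF that] t(2) by (meson less_ereal.simps(1) less_trans)
  have small: "b * (q * s ^ m * neg_ld_real (q * s ^ m)) < 1 - \<alpha>" if "0 \<le> s" "s < \<rho>" for s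
  proof -
    have "q * s ^ m * neg_ld_real (q * s ^ m) < t * neg_ld_real t"
      using that assms below[OF that] t by (intro times_neg_ld_strict_mono) auto
    thus ?thesis using t(3) assms by (simp add: field_simps)
  qed
  have root: "is_smallest_positive_root G \<rho>"
    unfolding is_smallest_positive_root_def
  proof (intro conjI allI impI)
    show "0 < \<rho>" by fact
    show "G \<rho> = 0" using eqn[of \<rho>] \<rho> t assms by auto
    fix s assume s: "0 < s \<and> G s = 0"
    show "\<rho> \<le> s"
    proof (rule ccontr)
      assume "\<not> \<rho> \<le> s"
      hence s': "0 < s" "s < \<rho>" using s by auto
      obtain N where "N \<noteq> 0" "G s = N * of_real (1 - \<alpha> - b * (q * s ^ m * neg_ld_real (q * s ^ m)))"
        using eqn[of s] s' belowR by auto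
      hence "1 - \<alpha> - b * (q * s ^ m * neg_ld_real (q * s ^ m)) = 0" using s by (metis mult_eq_0_iff of_real_eq_0_iff)
      thus False using small[of s] s' by linarith
    qed
  qed
  have "radius_of_starlikeness \<alpha> f = ereal \<rho>"
    unfolding radius_of_starlikeness_def
  proof (rule Sup_eqI)
    fix x assume "x \<in> {ereal r |r. 0 < r \<and> ereal r \<le> fps_conv_radius (fps_expansion f 0) \<and>
                        (\<forall>z\<in>ball 0 r. \<alpha> < Re (starlike_quotient f z))}"
    then obtain r where r: "x = ereal r" "0 < r" "\<And>z. z \<in> ball 0 r \<Longrightarrow> \<alpha> < Re (starlike_quotient f z)"
      by auto
    show "x \<le> ereal \<rho>"
    proof (rule ccontr)
      assume "\<not> x \<le> ereal \<rho>"
      hence "of_real \<rho> \<in> ball (0::complex) r" using \<rho> r by auto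
      hence "\<alpha> < Re (starlike_quotient f (of_real \<rho>))" by (rule r(3))
      also have "starlike_quotient f (of_real \<rho>) =
          1 - of_real b * (of_real q * of_real \<rho> ^ m * eval_fps neg_ld (of_real q * of_real \<rho> ^ m))"
        using \<rho> t assms by (simp add: starlike_quotient_def quot)
      also have "of_real q * of_real \<rho> ^ m = complex_of_real t"
        using \<rho>(2) by (metis of_real_mult of_real_power)
      also have "1 - of_real b * (of_real t * eval_fps neg_ld (of_real t)) = complex_of_real (1 - b * (t * neg_ld_real t))"
        using neg_ld_real_sums(2)[of t] t(1,2) by simp
      also have "1 - b * (t * neg_ld_real t) = \<alpha>" using t assms by simp
      finally show False by simp
    qed
  next
    fix u assume u: "\<And>x. x \<in> {ereal r |r. 0 < r \<and> ereal r \<le> fps_conv_radius (fps_expansion f 0) \<and>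
                        (\<forall>z\<in>ball 0 r. \<alpha> < Re (starlike_quotient f z))} \<Longrightarrow> x \<le> u"
    have "f holomorphic_on eball 0 (ereal \<rho>)"
      using hol[of \<rho>] \<rho> t by simp
    hence "ereal \<rho> \<le> fps_conv_radius (fps_expansion f 0)"
      by (rule conv_radius_fps_expansion)
    moreover have "\<alpha> < Re (starlike_quotient f z)" if z: "z \<in> ball 0 \<rho>" for z
    proof (cases "z = 0")
      case False
      let ?u = "of_real q * z ^ m"
      have nu: "norm ?u = q * norm z ^ m" using assms by (simp add: norm_mult norm_power)
      have inside: "ereal (q * norm z ^ m) < neg_ld_radius" using z by (intro belowR) auto
      have "Re (?u * eval_fps neg_ld ?u) \<le> norm ?u * norm (eval_fps neg_ld ?u)"
        by (metis complex_Re_le_cmod norm_mult)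
      also have "\<dots> \<le> norm ?u * neg_ld_real (norm ?u)"
        using inside nu by (intro mult_left_mono norm_neg_ld_le norm_ge_zero) simp
      finally have "b * Re (?u * eval_fps neg_ld ?u) \<le> b * (q * norm z ^ m * neg_ld_real (q * norm z ^ m))"
        using assms nu by simp
      also have "\<dots> < 1 - \<alpha>" using z by (intro small) auto
      finally show ?thesis
        using False inside by (simp add: starlike_quotient_def quot mult.assoc)
    qed (use assms in \<open>simp add: starlike_quotient_def\<close>)
    ultimately show "ereal \<rho> \<le> u" using \<rho> by (intro u) blast
  qed
  with root show ?thesis by blast
qed

end

section \<open>The Bessel-Clifford series and its Riccati equation\<close>

text \<open>
  The Bessel-Clifford series with alternating signs, normalized to have constant term \<open>1\<close>: the
  hypergeometric series \<open>0F1(a + 1; - u)\<close>.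
\<close>

definition clifford_fps :: "real \<Rightarrow> complex fps" where
  "clifford_fps a = Abs_fps (\<lambda>n. (- 1) ^ n / (fact n * pochhammer (of_real a + 1) n))"

lemma pochhammer_nonzero: "a > 0 \<Longrightarrow> pochhammer (complex_of_real a + 1) n \<noteq> 0"
  using pochhammer_pos[of "a + 1" n] pochhammer_of_real[of "a + 1" n, where ?'a = complex] by auto

lemma fps_conv_radius_clifford:
  assumes "a > 0"
  shows "fps_conv_radius (clifford_fps a) = \<infinity>"
proof -
  have "norm (fps_nth (clifford_fps a) n) \<le> norm (fps_nth (fps_exp (1::complex)) n)" for n
  proof -
    have "1 \<le> pochhammer (a + 1) n" unfolding pochhammer_prod
      using assms by (intro prod_ge_1) auto
    moreover have "norm (pochhammer (complex_of_real a + 1) n) = \<bar>pochhammer (a + 1) n\<bar>"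
      by (metis norm_of_real of_real_1 of_real_add pochhammer_of_real)
    ultimately show ?thesis
      by (simp add: clifford_fps_def norm_divide norm_mult norm_power field_simps)
  qed
  hence le: "norm (fps_nth (clifford_fps a) n * z ^ n) \<le> norm (fps_nth (fps_exp 1) n * z ^ n)" for n z
    by (simp only: norm_mult mult_right_mono norm_ge_zero)
  show ?thesis unfolding fps_conv_radius_def
  proof (rule conv_radius_inftyI'')
    fix z :: complex
    have "summable (\<lambda>n. norm (fps_nth (fps_exp 1) n * z ^ n))"
      by (intro norm_summable_fps) simp
    thus "summable (\<lambda>n. fps_nth (clifford_fps a) n * z ^ n)"
      by (rule summable_comparison_test'[where N = 0]) (rule le)
  qed
qed

lemma clifford_ode:
  assumes "a > 0"
  shows "fps_X * fps_deriv (fps_deriv (clifford_fps a)) + fps_const (of_real a + 1) * fps_deriv (clifford_fps a)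
    + clifford_fps a = 0"
proof (rule fps_ext)
  fix n
  let ?c = "fps_nth (clifford_fps a)"
  have rec: "(of_nat n + 1) * (of_real a + 1 + of_nat n) * ?c (Suc n) = - ?c n" for n
  proof -
    have "pochhammer (of_real a + 1 :: complex) (Suc n) = pochhammer (of_real a + 1) n * (of_real a + 1 + of_nat n)"
      by (rule pochhammer_Suc)
    hence "of_real a + 1 + of_nat n \<noteq> (0::complex)"
      using pochhammer_nonzero[OF assms, of "Suc n"] by auto
    moreover have "of_nat n + 1 \<noteq> (0::complex)" by (metis of_nat_Suc add.commute of_nat_eq_0_iff nat.distinct(1))
    moreover have "d * e * (- s / (d * f * (p * e))) = - (s / (f * p))"
      if "d \<noteq> 0" "e \<noteq> 0" for d e s f p :: complex
      using that by (simp add: divide_simps)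
    ultimately show ?thesis
      by (simp add: clifford_fps_def pochhammer_Suc ac_simps)
  qed
  show "fps_nth (fps_X * fps_deriv (fps_deriv (clifford_fps a)) + fps_const (of_real a + 1) * fps_deriv (clifford_fps a)
    + clifford_fps a) n = fps_nth 0 n"
    using rec[of n] by (cases n) (simp_all add: algebra_simps)
qed

lemma nonneg_Reals_sum:
  "(\<And>i. i \<in> I \<Longrightarrow> g i \<in> \<real>\<^sub>\<ge>\<^sub>0) \<Longrightarrow> (\<Sum>i\<in>I. g i :: complex) \<in> \<real>\<^sub>\<ge>\<^sub>0"
  by (induction I rule: infinite_finite_induct) auto

text \<open>
  Comparing coefficients gives \<open>(n + l) * H n = [n = 0] + (\<Sum>i<n. H i * H (n - 1 - i))\<close>, which for
  Bessel functions is the recursion of the Rayleigh sums.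
\<close>

lemma riccati_nonneg:
  fixes H :: "complex fps" and l :: real
  assumes "l > 0" and ric: "fps_X * fps_deriv H + fps_const (of_real l) * H = 1 + fps_X * H\<^sup>2"
  shows "fps_nth H n \<in> \<real>\<^sub>\<ge>\<^sub>0"
proof (induction n rule: less_induct)
  case (less n)
  have "(of_nat n + of_real l) * fps_nth H n = fps_nth (fps_X * fps_deriv H + fps_const (of_real l) * H) n"
    by (cases n) (simp_all add: algebra_simps)
  also have "\<dots> = (if n = 0 then 1 else \<Sum>i=0..n-1. fps_nth H i * fps_nth H (n - 1 - i))"
    by (cases n) (simp_all add: ric power2_eq_square fps_mult_nth[of H H])
  also have "\<dots> \<in> \<real>\<^sub>\<ge>\<^sub>0"
    by (cases "n = 0") (auto intro!: nonneg_Reals_sum nonneg_Reals_mult_I less)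
  finally have "(of_nat n + of_real l) * fps_nth H n \<in> \<real>\<^sub>\<ge>\<^sub>0" .
  moreover have "(of_nat n + of_real l :: complex) = of_real (n + l)" by simp
  ultimately have *: "of_real (n + l) * fps_nth H n \<in> \<real>\<^sub>\<ge>\<^sub>0" by metis
  have "inverse (complex_of_real (n + l)) * (of_real (n + l) * fps_nth H n) \<in> \<real>\<^sub>\<ge>\<^sub>0"
    using assms by (intro nonneg_Reals_mult_I * nonneg_Reals_inverse_I) (simp only: nonneg_Reals_of_real_iff)
  moreover have "complex_of_real (n + l) \<noteq> 0" using assms by (simp only: of_real_eq_0_iff)
  ultimately show ?case by (metis left_inverse mult.assoc mult_1)
qed

text \<open>
  Substituting \<open>F' = - H * F\<close> and \<open>F'' = (H\<^sup>2 - H') * F\<close> into the linear equation leaves the Riccati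
  equation times \<open>F\<close>.
\<close>

lemma clifford_riccati:
  assumes "a > 0"
  defines "F \<equiv> clifford_fps a"
  defines "H \<equiv> - fps_deriv F * inverse F"
  shows "fps_X * fps_deriv H + fps_const (of_real (a + 1)) * H = 1 + fps_X * H\<^sup>2"
proof -
  have F0: "fps_nth F 0 = 1" by (simp add: F_def clifford_fps_def)
  hence dF: "fps_deriv F = - H * F"
    by (simp add: H_def mult.assoc inverse_mult_eq_1)
  have ddF: "fps_deriv (fps_deriv F) = (- fps_deriv H + H\<^sup>2) * F"
    by (simp add: dF algebra_simps power2_eq_square)
  have "fps_X * fps_deriv (fps_deriv F) + fps_const (of_real (a + 1)) * fps_deriv F + F = 0"
    using clifford_ode[OF assms(1)] by (simp add: F_def)
  hence "fps_X * ((- fps_deriv H + H\<^sup>2) * F) + fps_const (of_real (a + 1)) * (- H * F) + F = 0"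
    by (simp only: ddF) (simp only: dF)
  moreover have "F * (1 + X * K - (X * D + C * H)) = X * ((- D + K) * F) + C * (- H * F) + F"
    for C D K X :: "complex fps"
    by (simp add: algebra_simps)
  ultimately have "F * (1 + fps_X * H\<^sup>2 - (fps_X * fps_deriv H + fps_const (of_real (a + 1)) * H)) = 0"
    by simp
  moreover have "F \<noteq> 0" using F0 by auto
  ultimately show ?thesis by simp
qed

lemma positive_log_derivative_clifford:
  assumes "a > 0"
  shows "positive_log_derivative (clifford_fps a)"
proof
  show "fps_conv_radius (clifford_fps a) = \<infinity>" by (rule fps_conv_radius_clifford) fact
  show "fps_nth (clifford_fps a) 0 = 1" by (simp add: clifford_fps_def)
  show "fps_nth (- fps_deriv (clifford_fps a) * inverse (clifford_fps a)) n \<in> \<real>\<^sub>\<ge>\<^sub>0" for n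
    using assms by (intro riccati_nonneg[OF _ clifford_riccati]) auto
  show "fps_nth (clifford_fps a) 1 \<noteq> 0"
    using pochhammer_nonzero[OF assms, of 1] by (simp add: clifford_fps_def)
qed

section \<open>The $k$-gamma function and the $k$-Bessel functions\<close>

text \<open>
  Substitute \<open>s = t powr k / k\<close> in Euler's integral for \<open>Gamma (x / k)\<close>.  The change-of-variables
  theorem requires absolute integrability, which the complex version of Euler's integral provides.
\<close>

lemma k_Gamma_of_real:
  assumes "k > 0" "x > 0"
  shows "k_Gamma k (of_real x) = of_real (k powr (x / k - 1) * Gamma (x / k))"
proof -
  define f where "f = (\<lambda>s::real. s powr (x / k - 1) / exp s)"
  define g where "g = (\<lambda>t::real. t powr k / k)"
  have "(\<lambda>t. of_real (f t) :: complex) absolutely_integrable_on {0<..}"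
    by (rule absolutely_integrable_spike[OF absolutely_integrable_Gamma_integral'[of "of_real (x / k)"] negligible_empty])
      (use assms in \<open>auto simp: f_def powr_of_real[symmetric]\<close>)
  hence "(Re \<circ> (\<lambda>t. of_real (f t) :: complex)) absolutely_integrable_on {0<..}"
    by (rule absolutely_integrable_linear) (rule bounded_linear_Re)
  hence int: "f absolutely_integrable_on {0<..}" by (simp add: o_def)
  have "((\<lambda>t. of_real (f t) :: complex) has_integral Gamma (of_real (x / k))) {0<..}"
    by (rule has_integral_eq[OF _ Gamma_integral_complex'])
      (use assms in \<open>auto simp: f_def powr_of_real[symmetric]\<close>)
  hence "((Re \<circ> (\<lambda>t. of_real (f t) :: complex)) has_integral Re (Gamma (of_real (x / k)))) {0<..}"
    by (rule has_integral_linear) (rule bounded_linear_Re)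
  hence val: "integral {0<..} f = Gamma (x / k)"
    by (simp add: o_def Gamma_complex_of_real integral_unique del: of_real_divide)
  have image: "g ` {0<..} = {0<..}"
  proof -
    have "s \<in> g ` {0<..}" if "s > 0" for s
      using assms that by (intro image_eqI[of _ _ "(k * s) powr (1 / k)"]) (auto simp: g_def powr_powr)
    thus ?thesis using assms by (auto simp: g_def)
  qed
  have inj: "inj_on g {0<..}"
    using assms by (intro strict_mono_on_imp_inj_on strict_mono_onI) (auto simp: g_def divide_strict_right_mono powr_less_mono2)
  have der: "(g has_field_derivative t powr (k - 1)) (at t within {0<..})" if "t \<in> {0<..}" for t
    using that assms unfolding g_def by (auto intro!: derivative_eq_intros)
  have "(\<lambda>t. \<bar>t powr (k - 1)\<bar> * f (g t)) absolutely_integrable_on {0<..} \<and>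
      integral {0<..} (\<lambda>t. \<bar>t powr (k - 1)\<bar> * f (g t)) = Gamma (x / k)"
    by (subst has_absolute_integral_change_of_variables_1'[OF _ der inj])
      (use int val image in auto)
  hence "((\<lambda>t. \<bar>t powr (k - 1)\<bar> * f (g t)) has_integral Gamma (x / k)) {0<..}"
    by (simp only: has_integral_iff set_lebesgue_integral_eq_integral(1))
  hence "((\<lambda>t. k powr (x / k - 1) * (\<bar>t powr (k - 1)\<bar> * f (g t)))
      has_integral (k powr (x / k - 1) * Gamma (x / k))) {0<..}"
    by (rule has_integral_mult_right)
  hence "((\<lambda>t. complex_of_real (k powr (x / k - 1) * (\<bar>t powr (k - 1)\<bar> * f (g t))))
      has_integral of_real (k powr (x / k - 1) * Gamma (x / k))) {0<..}"
    by (rule has_integral_of_real)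
  moreover have "complex_of_real (k powr (x / k - 1) * (\<bar>t powr (k - 1)\<bar> * f (g t))) =
      of_real t powr (of_real x - 1) * of_real (exp (- (t powr k) / k))" if "t \<in> {0<..}" for t
  proof -
    have t: "t > 0" using that by simp
    have "f (g t) = t powr (x - k) / k powr (x / k - 1) * exp (- (t powr k) / k)"
    proof -
      have "t powr (k * (x / k - 1)) = t powr (x - k)"
        using assms by (intro arg_cong[of _ _ "(powr) t"]) (simp add: field_simps)
      thus ?thesis
        using t assms by (simp add: f_def g_def powr_divide powr_powr exp_minus inverse_eq_divide)
    qed
    hence "k powr (x / k - 1) * (\<bar>t powr (k - 1)\<bar> * f (g t)) =
        t powr (k - 1) * t powr (x - k) * exp (- (t powr k) / k)"
      using assms by simp
    also have "t powr (k - 1) * t powr (x - k) = t powr (x - 1)"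
      by (simp flip: powr_add)
    finally show ?thesis using t by (simp add: powr_of_real[symmetric])
  qed
  ultimately have "((\<lambda>t. of_real t powr (of_real x - 1) * of_real (exp (- (t powr k) / k)))
      has_integral complex_of_real (k powr (x / k - 1) * Gamma (x / k))) {0<..}"
    by (rule has_integral_eq[rotated])
  thus ?thesis unfolding k_Gamma_def by (rule integral_unique)
qed

lemma k_Gamma_shift:
  assumes "k > 0" "\<nu> > 0"
  shows "k_Gamma k (of_real (real n * k + \<nu> + k)) =
      of_real k ^ n * pochhammer (of_real (\<nu> / k) + 1) n * k_Gamma k (of_real (\<nu> + k))"
proof -
  let ?b = "\<nu> / k + 1"
  have b: "?b > 0" using assms by (intro add_pos_pos) auto
  have "pochhammer ?b n = Gamma (?b + real n) / Gamma ?b"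
    using b by (intro pochhammer_Gamma) (auto elim!: nonpos_Ints_cases)
  moreover have "Gamma ?b > 0" using b by (rule Gamma_real_pos)
  ultimately have Gam: "Gamma (?b + real n) = pochhammer ?b n * Gamma ?b" by (simp add: field_simps)
  have "k_Gamma k (of_real (real n * k + \<nu> + k)) =
      of_real (k powr ((real n * k + \<nu> + k) / k - 1) * Gamma ((real n * k + \<nu> + k) / k))"
    using assms by (intro k_Gamma_of_real) (auto intro!: add_nonneg_pos)
  also have "(real n * k + \<nu> + k) / k = ?b + real n"
    using assms by (simp add: field_simps)
  also have "k powr (?b + real n - 1) = k ^ n * k powr (?b - 1)"
    using assms by (simp add: powr_add powr_realpow)
  also have "complex_of_real (k ^ n * k powr (?b - 1) * Gamma (?b + real n)) =
      of_real k ^ n * of_real (pochhammer ?b n) * of_real (k powr (?b - 1) * Gamma ?b)"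
    by (simp add: Gam)
  also have "complex_of_real (pochhammer ?b n) = pochhammer (of_real (\<nu> / k) + 1) n"
    by (simp add: pochhammer_of_real[symmetric])
  also have "?b = (\<nu> + k) / k" using assms by (simp add: field_simps)
  also have "complex_of_real (k powr ((\<nu> + k) / k - 1) * Gamma ((\<nu> + k) / k)) = k_Gamma k (of_real (\<nu> + k))"
    using assms by (intro k_Gamma_of_real[symmetric]) auto
  finally show ?thesis .
qed

lemma k_Gamma_nonzero:
  assumes "k > 0" "x > 0"
  shows "k_Gamma k (of_real x) \<noteq> 0"
proof -
  have "Gamma (x / k) > 0" using assms by (intro Gamma_real_pos) auto
  hence "k powr (x / k - 1) * Gamma (x / k) > 0" using assms by (intro mult_pos_pos) auto
  hence "k powr (x / k - 1) * Gamma (x / k) \<noteq> 0" by (rule less_imp_neq[symmetric])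
  thus ?thesis unfolding k_Gamma_of_real[OF assms] of_real_eq_0_iff .
qed

lemma k_Bessel_sums:
  assumes "k > 0" "\<nu> > 0"
  shows "(\<lambda>n. (- of_real c) ^ n / (fact n * k_Gamma k (of_real (real n * k + \<nu> + k))) * (z / 2) ^ (2 * n))
    sums (eval_fps (clifford_fps (\<nu> / k)) (of_real (c / (4 * k)) * z\<^sup>2) / k_Gamma k (of_real (\<nu> + k)))"
proof -
  let ?G = "k_Gamma k (of_real (\<nu> + k))" and ?u = "of_real (c / (4 * k)) * z\<^sup>2"
  have "(\<lambda>n. fps_nth (clifford_fps (\<nu> / k)) n * ?u ^ n / ?G) sums (eval_fps (clifford_fps (\<nu> / k)) ?u / ?G)"
    using assms by (intro sums_divide sums_eval_fps) (simp add: fps_conv_radius_clifford)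
  also have "(\<lambda>n. fps_nth (clifford_fps (\<nu> / k)) n * ?u ^ n / ?G) =
      (\<lambda>n. (- of_real c) ^ n / (fact n * k_Gamma k (of_real (real n * k + \<nu> + k))) * (z / 2) ^ (2 * n))"
  proof
    fix n
    have u: "?u ^ n = of_real c ^ n * (z / 2) ^ (2 * n) / of_real k ^ n"
      by (simp add: power_mult power_divide power_mult_distrib)
    have m: "(- of_real c) ^ n = (- 1) ^ n * (of_real c ^ n :: complex)"
      by (rule power_minus)
    show "fps_nth (clifford_fps (\<nu> / k)) n * ?u ^ n / ?G =
      (- of_real c) ^ n / (fact n * k_Gamma k (of_real (real n * k + \<nu> + k))) * (z / 2) ^ (2 * n)"
      unfolding k_Gamma_shift[OF assms] u m clifford_fps_def fps_nth_Abs_fps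
      by (simp only: times_divide_eq_left times_divide_eq_right divide_divide_eq_left mult_ac)
  qed
  finally show ?thesis .
qed

lemma k_Bessel_w_eq:
  assumes "k > 0" "\<nu> > 0"
  shows "k_Bessel_w k \<nu> c z = eval_fps (clifford_fps (\<nu> / k)) (of_real (c / (4 * k)) * z\<^sup>2)"
proof -
  have "k_Gamma k (of_real (\<nu> + k)) \<noteq> 0" using assms by (intro k_Gamma_nonzero) auto
  thus ?thesis
    unfolding k_Bessel_w_def sums_unique[OF k_Bessel_sums[OF assms, of c z], symmetric]
    by (simp del: of_real_add)
qed

text \<open>
  The factor \<open>(z / 2) powr (\<nu> / k)\<close> splits off each term on the whole plane: \<open>powr_add\<close> holds for a
  common logarithm, and at \<open>z = 0\<close> both sides vanish.
\<close>

lemma k_Bessel_W_eq: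
  assumes "k > 0" "\<nu> > 0"
  shows "k_Bessel_W k \<nu> c z = (z / 2) powr of_real (\<nu> / k) *
    eval_fps (clifford_fps (\<nu> / k)) (of_real (c / (4 * k)) * z\<^sup>2) / k_Gamma k (of_real (\<nu> + k))"
proof -
  have pow: "(z / 2) ^ (2 * n) * (z / 2) powr of_real (\<nu> / k) = (z / 2) powr of_real (2 * real n + \<nu> / k)" for n
  proof (cases "z = 0")
    case False
    have "complex_of_real (2 * real n + \<nu> / k) = of_nat (2 * n) + of_real (\<nu> / k)" by simp
    hence "(z / 2) powr of_real (2 * real n + \<nu> / k) = (z / 2) powr of_nat (2 * n) * (z / 2) powr of_real (\<nu> / k)"
      by (simp only: powr_add)
    thus ?thesis using False by (subst (asm) powr_nat') auto
  qed simp
  show ?thesis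
    using sums_unique[OF sums_mult2[OF k_Bessel_sums[OF assms, of c z], of "(z / 2) powr of_real (\<nu> / k)"]]
    unfolding k_Bessel_W_def mult.assoc pow by (simp add: mult.commute)
qed

lemma powr_half:
  "(z / 2 :: complex) powr of_real a = z powr of_real a / 2 powr of_real a"
  using Ln_divide_of_real[of 2 z]
  by (cases "z = 0") (auto simp: powr_def ring_distribs exp_diff Ln_of_real[symmetric])

lemma k_Bessel_g_eq:
  assumes "k > 0" "\<nu> > 0"
  shows "k_Bessel_g k \<nu> c z = z * eval_fps (clifford_fps (\<nu> / k)) (of_real (c / (4 * k)) * z\<^sup>2)"
proof (cases "z = 0")
  case False
  have "z powr of_real (1 - \<nu> / k) * z powr of_real (\<nu> / k) = z"
    using False by (simp flip: powr_add of_real_add)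
  moreover have "k_Gamma k (of_real (\<nu> + k)) \<noteq> 0" using assms by (intro k_Gamma_nonzero) auto
  moreover have "A * G * P1 * (P2 / A * E / G) = (P1 * P2) * E" if "A \<noteq> 0" "G \<noteq> 0" for A G P1 P2 E :: complex
    using that by simp
  ultimately show ?thesis
    unfolding k_Bessel_g_def k_Bessel_W_eq[OF assms] powr_half by (simp del: of_real_add)
qed (simp add: k_Bessel_g_def)

text \<open>
  The principal square root halves the argument, so its logarithm is half the principal one.
\<close>

lemma csqrt_powr: "csqrt z powr s = z powr (s / 2)"
proof (cases "z = 0")
  case False
  have "Ln (csqrt z) = Ln z / 2"
    using False mpi_less_Im_Ln[of z] Im_Ln_le_pi[of z]
    by (simp add: csqrt_exp_Ln del: exp_Ln)
  hence "s * Ln (csqrt z) = s / 2 * Ln z" by (simp only: times_divide_eq_left times_divide_eq_right)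
  thus ?thesis using False by (simp only: powr_def csqrt_eq_0 if_False)
qed simp

lemma k_Bessel_h_eq:
  assumes "k > 0" "\<nu> > 0"
  shows "k_Bessel_h k \<nu> c z = z * eval_fps (clifford_fps (\<nu> / k)) (of_real (c / (4 * k)) * z)"
proof (cases "z = 0")
  case False
  have "z powr of_real (1 - \<nu> / (2 * k)) * csqrt z powr of_real (\<nu> / k) =
      z powr (of_real (1 - \<nu> / (2 * k)) + of_real (\<nu> / k) / 2)"
    by (simp only: csqrt_powr powr_add)
  also have "of_real (1 - \<nu> / (2 * k)) + of_real (\<nu> / k) / 2 = (1 :: complex)" by simp
  finally have "z powr of_real (1 - \<nu> / (2 * k)) * csqrt z powr of_real (\<nu> / k) = z"
    using False by simp
  moreover have "k_Gamma k (of_real (\<nu> + k)) \<noteq> 0" using assms by (intro k_Gamma_nonzero) auto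
  moreover have "A * G * P1 * (P2 / A * E / G) = (P1 * P2) * E" if "A \<noteq> 0" "G \<noteq> 0" for A G P1 P2 E :: complex
    using that by simp
  ultimately show ?thesis
    unfolding k_Bessel_h_def k_Bessel_W_eq[OF assms] powr_half by (simp del: of_real_add)
qed (simp add: k_Bessel_h_def)

section \<open>The analytic branch of the logarithm on the zero-free disk\<close>

lemma ball_subset_zero_free_disk:
  "(\<And>z. z \<in> ball 0 r \<Longrightarrow> w z \<noteq> 0) \<Longrightarrow> ball 0 r \<subseteq> zero_free_disk w"
  unfolding zero_free_disk_def by blast

text \<open>
  A zero-free disk is star-shaped about \<open>0\<close>, hence contractible, so \<open>w\<close> has an analytic logarithm
  there; subtracting its value at \<open>0\<close> normalizes it.
\<close>

lemma log_branch:
  assumes "w holomorphic_on UNIV" "w 0 = 1"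
  shows "log_branch w holomorphic_on zero_free_disk w"
    and "z \<in> zero_free_disk w \<Longrightarrow> exp (log_branch w z) = w z"
proof -
  let ?S = "zero_free_disk w"
  have "\<exists>L. L holomorphic_on ?S \<and> L 0 = 0 \<and> (\<forall>z\<in>?S. exp (L z) = w z)"
  proof (cases "?S = {}")
    case True
    thus ?thesis by (intro exI[of _ "\<lambda>_. 0"]) auto
  next
    case False
    then obtain r where r: "ball (0 :: complex) r \<noteq> {}" "\<And>z. z \<in> ball 0 r \<Longrightarrow> w z \<noteq> 0"
      unfolding zero_free_disk_def by blast
    hence "0 \<in> ?S" using ball_subset_zero_free_disk[of r w] by (auto simp: not_le)
    moreover have "closed_segment 0 z \<subseteq> ?S" if z: "z \<in> ?S" for z
    proof -
      obtain s where s: "z \<in> ball 0 s" "\<forall>x\<in>ball 0 s. w x \<noteq> 0"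
        using z unfolding zero_free_disk_def by blast
      have "closed_segment 0 z \<subseteq> ball 0 s"
        using s(1) by (intro closed_segment_subset convex_ball) (auto intro: le_less_trans[of 0 "norm z"])
      thus ?thesis using ball_subset_zero_free_disk[of s w] s(2) by blast
    qed
    ultimately have "starlike ?S" unfolding starlike_def by blast
    hence "contractible ?S" by (rule starlike_imp_contractible)
    moreover have "w holomorphic_on ?S" using assms(1) by (rule holomorphic_on_subset) auto
    moreover have "w z \<noteq> 0" if "z \<in> ?S" for z using that by (auto simp: zero_free_disk_def)
    ultimately obtain g where g: "g holomorphic_on ?S" "\<And>z. z \<in> ?S \<Longrightarrow> w z = exp (g z)"
      by (metis contractible_imp_holomorphic_log)
    have "(\<lambda>z. g z - g 0) holomorphic_on ?S" by (intro holomorphic_intros g)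
    moreover have "exp (g z - g 0) = w z" if "z \<in> ?S" for z
      using g(2)[OF that] g(2)[OF \<open>0 \<in> ?S\<close>] assms(2) by (simp add: exp_diff)
    ultimately show ?thesis by (intro exI[of _ "\<lambda>z. g z - g 0"]) auto
  qed
  from someI_ex[OF this] show "log_branch w holomorphic_on ?S"
    and "z \<in> ?S \<Longrightarrow> exp (log_branch w z) = w z"
    by (auto simp: log_branch_def)
qed

text \<open>
  This makes the logarithmic derivative of \<open>f z = z * exp (k / \<nu> * log_branch w z)\<close> independent of the
  choice of the branch.
\<close>

lemma deriv_log_branch:
  assumes w: "w holomorphic_on UNIV" "w 0 = 1" and z: "z \<in> zero_free_disk w"
  shows "(log_branch w has_field_derivative deriv w z / w z) (at z)"
proof -
  let ?S = "zero_free_disk w" and ?L = "log_branch w"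
  have op: "open ?S" unfolding zero_free_disk_def by (intro open_Union) auto
  have dL: "(?L has_field_derivative deriv ?L z) (at z)"
    using log_branch(1)[OF w] op z by (rule holomorphic_derivI)
  have "((\<lambda>x. exp (?L x)) has_field_derivative deriv w z) (at z)"
  proof (rule has_field_derivative_transform_within_open[OF _ op z])
    show "(w has_field_derivative deriv w z) (at z)"
      using w(1) by (rule holomorphic_derivI) auto
  qed (use log_branch(2)[OF w] in auto)
  moreover have "((\<lambda>x. exp (?L x)) has_field_derivative exp (?L z) * deriv ?L z) (at z)"
    by (rule DERIV_chain2[OF DERIV_exp dL])
  ultimately have "deriv w z = exp (?L z) * deriv ?L z" by (rule DERIV_unique)
  hence "deriv ?L z = deriv w z / w z" by (simp add: log_branch(2)[OF w z, symmetric])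
  thus ?thesis using dL by simp
qed

section \<open>The three radii of starlikeness\<close>

theorem theorem1p1:
  fixes k c \<nu> \<alpha> :: real
  assumes "k > 0" and "c > 0" and "\<nu> > 0" and "0 \<le> \<alpha>" and "\<alpha> < 1"
  shows "(\<exists>\<rho>. is_smallest_positive_root
            (\<lambda>r. of_real k * of_real r * deriv (k_Bessel_W k \<nu> c) (of_real r)
                 - of_real (\<nu> * \<alpha>) * k_Bessel_W k \<nu> c (of_real r)) \<rho>
          \<and> radius_of_starlikeness \<alpha> (k_Bessel_f k \<nu> c) = ereal \<rho>)
       \<and> (\<exists>\<rho>. is_smallest_positive_root
            (\<lambda>r. of_real r * deriv (k_Bessel_W k \<nu> c) (of_real r)
                 - of_real (\<alpha> + \<nu> / k - 1) * k_Bessel_W k \<nu> c (of_real r)) \<rho>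
          \<and> radius_of_starlikeness \<alpha> (k_Bessel_g k \<nu> c) = ereal \<rho>)
       \<and> (\<exists>\<rho>. is_smallest_positive_root
            (\<lambda>r. of_real (sqrt r) * deriv (k_Bessel_W k \<nu> c) (of_real (sqrt r))
                 - of_real (2 * (\<alpha> + \<nu> / (2 * k) - 1)) * k_Bessel_W k \<nu> c (of_real (sqrt r))) \<rho>
          \<and> radius_of_starlikeness \<alpha> (k_Bessel_h k \<nu> c) = ereal \<rho>)"
proof -
  define a where "a = \<nu> / k"
  define q where "q = c / (4 * k)"
  have aq: "a > 0" "q > 0" using assms by (auto simp: a_def q_def)
  interpret positive_log_derivative "clifford_fps a"
    by (rule positive_log_derivative_clifford) fact
  define \<Phi> where "\<Phi> = eval_fps (clifford_fps a)"
  note \<Phi>_nz = F_nonzero[folded \<Phi>_def]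
  have d\<Phi>: "((\<lambda>z. \<Phi> (of_real q * z\<^sup>2)) has_field_derivative
      - 2 * of_real q * z * (eval_fps neg_ld (of_real q * z\<^sup>2) * \<Phi> (of_real q * z\<^sup>2))) (at z)"
    if "ereal (q * norm z ^ 2) < neg_ld_radius" for z
  proof -
    have "norm (of_real q * z\<^sup>2) = q * norm z ^ 2" using aq by (simp add: norm_mult norm_power)
    hence "(\<Phi> has_field_derivative - eval_fps neg_ld (of_real q * z\<^sup>2) * \<Phi> (of_real q * z\<^sup>2)) (at (of_real q * z\<^sup>2))"
      using that unfolding \<Phi>_def by (intro has_derivative_F) simp
    thus ?thesis
      by (rule DERIV_chain2[THEN DERIV_cong]) (auto intro!: derivative_eq_intros)
  qed
  have \<Phi>_hol: "\<Phi> holomorphic_on S" for S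
    unfolding \<Phi>_def by (intro holomorphic_on_eval_fps) (simp add: entire)
  have nz2: "\<Phi> (of_real q * z ^ m) \<noteq> 0" if "ereal (q * norm z ^ m) < neg_ld_radius" for z m
    using that aq by (intro \<Phi>_nz) (simp add: norm_mult norm_power)

  define W where "W = k_Bessel_W k \<nu> c"
  have W: "W = (\<lambda>z. (z / 2) powr of_real a * \<Phi> (of_real q * z\<^sup>2) / k_Gamma k (of_real (\<nu> + k)))"
    unfolding W_def \<Phi>_def a_def q_def by (intro ext k_Bessel_W_eq assms)
  \<comment> \<open>The identity \<open>r * W' r / W r = a - 2 * (q * r\<^sup>2 * H (q * r\<^sup>2))\<close> evaluates all three equations.\<close>
  have W_nz: "W (of_real r) \<noteq> 0"
    and dW: "of_real r * deriv W (of_real r) = W (of_real r) * of_real (a - 2 * (q * r\<^sup>2 * neg_ld_real (q * r\<^sup>2)))"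
    if r: "r > 0" "ereal (q * r\<^sup>2) < neg_ld_radius" for r
  proof -
    have G: "k_Gamma k (of_real (\<nu> + k)) \<noteq> 0" using assms by (intro k_Gamma_nonzero) auto
    show "W (of_real r) \<noteq> 0"
      using r G nz2[of "of_real r" 2] by (auto simp: W)
    have yY: "eval_fps neg_ld (of_real q * of_real r ^ 2) = of_real (neg_ld_real (q * r\<^sup>2))"
      using neg_ld_real_sums(2)[of "q * r\<^sup>2"] r aq by simp
    have p: "(of_real r / 2) powr (of_real a - 1) = (of_real r / 2) powr of_real a / (complex_of_real r / 2)"
      using r by (simp add: powr_diff)
    have "((\<lambda>z :: complex. (z / 2) powr of_real a) has_field_derivative
        (of_real a * (of_real r / 2) powr (of_real a - 1)) * (1 / 2)) (at (of_real r))"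
      using r by (intro DERIV_chain2[OF has_field_derivative_powr]) (auto intro!: derivative_eq_intros simp: complex_nonpos_Reals_iff)
    hence "(W has_field_derivative
       ((of_real a * (of_real r / 2) powr (of_real a - 1)) * (1 / 2) * \<Phi> (of_real q * of_real r ^ 2)
        + (- 2 * of_real q * of_real r * (eval_fps neg_ld (of_real q * of_real r ^ 2) * \<Phi> (of_real q * of_real r ^ 2)))
          * (of_real r / 2) powr of_real a) / k_Gamma k (of_real (\<nu> + k))) (at (of_real r))"
      unfolding W using r by (intro DERIV_cdivide DERIV_mult d\<Phi>) auto
    from DERIV_imp_deriv[OF this] show "of_real r * deriv W (of_real r) = W (of_real r) * of_real (a - 2 * (q * r\<^sup>2 * neg_ld_real (q * r\<^sup>2)))"
      using r G unfolding p yY by (simp add: W field_simps power2_eq_square)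
  qed

  have g: "k_Bessel_g k \<nu> c = (\<lambda>z. z * \<Phi> (of_real q * z\<^sup>2))"
    unfolding \<Phi>_def a_def q_def by (intro ext k_Bessel_g_eq assms)
  have h: "k_Bessel_h k \<nu> c = (\<lambda>z. z * \<Phi> (of_real q * z))"
    unfolding \<Phi>_def a_def q_def by (intro ext k_Bessel_h_eq assms)

  have A: "\<exists>\<rho>. is_smallest_positive_root
            (\<lambda>r. of_real k * of_real r * deriv W (of_real r)
                 - of_real (\<nu> * \<alpha>) * W (of_real r)) \<rho>
          \<and> radius_of_starlikeness \<alpha> (k_Bessel_f k \<nu> c) = ereal \<rho>"
  proof (rule radius_of_starlikeness_eq_root[where q = q and b = "2 * (k / \<nu>)" and m = 2])
    define w where "w = k_Bessel_w k \<nu> c"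
    have w: "w = (\<lambda>z. \<Phi> (of_real q * z\<^sup>2))"
      unfolding w_def \<Phi>_def a_def q_def by (intro ext k_Bessel_w_eq assms)
    have "(\<Phi> \<circ> (\<lambda>z. of_real q * z\<^sup>2)) holomorphic_on UNIV"
      by (intro holomorphic_on_compose \<Phi>_hol holomorphic_intros)
    hence w_hol: "w holomorphic_on UNIV" by (simp add: w o_def)
    have w0: "w 0 = 1" by (simp add: w \<Phi>_def eval_fps_at_0 at_zero)
    define L where "L = log_branch w"
    have L: "L holomorphic_on zero_free_disk w"
      unfolding L_def by (rule log_branch(1)[OF w_hol w0])
    have f: "k_Bessel_f k \<nu> c = (\<lambda>z. z * exp (of_real (k / \<nu>) * L z))"
      by (intro ext) (simp add: k_Bessel_f_def L_def w_def)
    have sub: "ball 0 r \<subseteq> zero_free_disk w" if r: "ereal (q * r\<^sup>2) < neg_ld_radius" for r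
    proof (rule ball_subset_zero_free_disk)
      fix z :: complex assume "z \<in> ball 0 r"
      hence "q * norm z ^ 2 \<le> q * r\<^sup>2" using aq by (intro mult_left_mono power_mono) auto
      thus "w z \<noteq> 0" unfolding w using r by (intro nz2) (meson ereal_less_eq(3) le_less_trans)
    qed
    show "k_Bessel_f k \<nu> c holomorphic_on ball 0 r" if "ereal (q * r\<^sup>2) < neg_ld_radius" for r
      unfolding f by (intro holomorphic_intros holomorphic_on_subset[OF L sub[OF that]])
    show "z * deriv (k_Bessel_f k \<nu> c) z / k_Bessel_f k \<nu> c z =
        1 - of_real (2 * (k / \<nu>)) * (of_real q * z ^ 2 * eval_fps neg_ld (of_real q * z ^ 2))"
      if z: "z \<noteq> 0" "ereal (q * norm z ^ 2) < neg_ld_radius" for z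
    proof -
      \<comment> \<open>The zero-free disk is a union of open disks about \<open>0\<close>, so a radius larger than \<open>norm z\<close> is needed.\<close>
      obtain s where s: "norm z < s" "ereal (q * s\<^sup>2) < neg_ld_radius"
      proof -
        obtain t where t: "ereal (q * norm z ^ 2) < ereal t" "ereal t < neg_ld_radius"
          using ereal_dense2[OF z(2)] by blast
        hence "norm z ^ 2 < t / q" using aq by (simp add: field_simps)
        hence "norm z < sqrt (t / q)" by (metis real_less_rsqrt)
        moreover have "0 \<le> q * norm z ^ 2" using aq by simp
        hence "0 \<le> t" using t(1) by simp
        hence "q * (sqrt (t / q))\<^sup>2 = t" using aq by simp
        ultimately show ?thesis using t(2) that[of "sqrt (t / q)"] by simp
      qed
      have z_in: "z \<in> zero_free_disk w" using s(1) sub[OF s(2)] by auto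
      have w_nz: "w z \<noteq> 0" unfolding w by (rule nz2) (rule z(2))
      have "deriv w z = - 2 * of_real q * z * (eval_fps neg_ld (of_real q * z\<^sup>2) * w z)"
        unfolding w by (intro DERIV_imp_deriv d\<Phi> z)
      hence dL': "deriv w z / w z = - 2 * of_real q * z * eval_fps neg_ld (of_real q * z\<^sup>2)"
        using w_nz by simp
      have dL: "(L has_field_derivative deriv w z / w z) (at z)"
        unfolding L_def by (rule deriv_log_branch[OF w_hol w0 z_in])
      let ?E = "exp (of_real (k / \<nu>) * L z)"
      have "(k_Bessel_f k \<nu> c has_field_derivative
          1 * ?E + ?E * (of_real (k / \<nu>) * (deriv w z / w z)) * z) (at z)"
        unfolding f by (intro DERIV_mult DERIV_ident DERIV_chain2[OF DERIV_exp] DERIV_cmult dL)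
      hence "deriv (k_Bessel_f k \<nu> c) z = ?E * (1 + of_real (k / \<nu>) * (deriv w z / w z) * z)"
        by (simp add: DERIV_imp_deriv algebra_simps)
      hence "z * deriv (k_Bessel_f k \<nu> c) z / k_Bessel_f k \<nu> c z = 1 + of_real (k / \<nu>) * (deriv w z / w z) * z"
        using z(1) unfolding f by simp
      also have "\<dots> = 1 - of_real (2 * (k / \<nu>)) * (of_real q * z ^ 2 * eval_fps neg_ld (of_real q * z ^ 2))"
        unfolding dL' by (simp add: power2_eq_square algebra_simps)
      finally show ?thesis .
    qed
    show "\<exists>N. N \<noteq> 0 \<and> of_real k * of_real r * deriv W (of_real r) - of_real (\<nu> * \<alpha>) * W (of_real r) =
        N * of_real (1 - \<alpha> - 2 * (k / \<nu>) * (q * r\<^sup>2 * neg_ld_real (q * r\<^sup>2)))"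
      if r: "r > 0" "ereal (q * r\<^sup>2) < neg_ld_radius" for r
    proof (intro exI[of _ "of_real \<nu> * W (of_real r)"] conjI)
      show "of_real \<nu> * W (of_real r) \<noteq> 0" using W_nz[OF r] assms by simp
      have "of_real k * of_real r * deriv W (of_real r) - of_real (\<nu> * \<alpha>) * W (of_real r) =
          of_real (k * (a - 2 * (q * r\<^sup>2 * neg_ld_real (q * r\<^sup>2))) - \<nu> * \<alpha>) * W (of_real r)"
        by (simp only: mult.assoc dW[OF r]) (simp add: algebra_simps)
      also have "k * (a - 2 * (q * r\<^sup>2 * neg_ld_real (q * r\<^sup>2))) - \<nu> * \<alpha> =
          \<nu> * (1 - \<alpha> - 2 * (k / \<nu>) * (q * r\<^sup>2 * neg_ld_real (q * r\<^sup>2)))"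
        using assms by (simp add: a_def field_simps)
      finally show "of_real k * of_real r * deriv W (of_real r) - of_real (\<nu> * \<alpha>) * W (of_real r) =
          of_real \<nu> * W (of_real r) * of_real (1 - \<alpha> - 2 * (k / \<nu>) * (q * r\<^sup>2 * neg_ld_real (q * r\<^sup>2)))"
        by simp
    qed
  qed (use assms aq in auto)

  have B: "\<exists>\<rho>. is_smallest_positive_root
            (\<lambda>r. of_real r * deriv W (of_real r)
                 - of_real (\<alpha> + \<nu> / k - 1) * W (of_real r)) \<rho>
          \<and> radius_of_starlikeness \<alpha> (k_Bessel_g k \<nu> c) = ereal \<rho>"
  proof (rule radius_of_starlikeness_eq_root[where q = q and b = 2 and m = 2])
    have "(\<Phi> \<circ> (\<lambda>z. of_real q * z\<^sup>2)) holomorphic_on S" for S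
      by (intro holomorphic_on_compose \<Phi>_hol holomorphic_intros)
    thus "k_Bessel_g k \<nu> c holomorphic_on ball 0 r" for r
      unfolding g by (intro holomorphic_intros) (simp add: o_def)
    show "z * deriv (k_Bessel_g k \<nu> c) z / k_Bessel_g k \<nu> c z =
        1 - of_real 2 * (of_real q * z ^ 2 * eval_fps neg_ld (of_real q * z ^ 2))"
      if z: "z \<noteq> 0" "ereal (q * norm z ^ 2) < neg_ld_radius" for z
    proof -
      have "deriv (k_Bessel_g k \<nu> c) z = 1 * \<Phi> (of_real q * z\<^sup>2) +
          - 2 * of_real q * z * (eval_fps neg_ld (of_real q * z\<^sup>2) * \<Phi> (of_real q * z\<^sup>2)) * z"
        unfolding g by (intro DERIV_imp_deriv DERIV_mult DERIV_ident d\<Phi> z)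
      thus ?thesis using z(1) nz2[OF z(2)] unfolding g
        by (simp add: field_simps power2_eq_square)
    qed
    show "\<exists>N. N \<noteq> 0 \<and> of_real r * deriv W (of_real r) - of_real (\<alpha> + \<nu> / k - 1) * W (of_real r) =
        N * of_real (1 - \<alpha> - 2 * (q * r\<^sup>2 * neg_ld_real (q * r\<^sup>2)))"
      if r: "r > 0" "ereal (q * r\<^sup>2) < neg_ld_radius" for r
      using W_nz[OF r] unfolding dW[OF r]
      by (intro exI[of _ "W (of_real r)"]) (simp add: a_def algebra_simps)
  qed (use assms aq in auto)

  have C: "\<exists>\<rho>. is_smallest_positive_root
            (\<lambda>r. of_real (sqrt r) * deriv W (of_real (sqrt r))
                 - of_real (2 * (\<alpha> + \<nu> / (2 * k) - 1)) * W (of_real (sqrt r))) \<rho>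
          \<and> radius_of_starlikeness \<alpha> (k_Bessel_h k \<nu> c) = ereal \<rho>"
  proof (rule radius_of_starlikeness_eq_root[where q = q and b = 1 and m = 1])
    have "(\<Phi> \<circ> (\<lambda>z. of_real q * z)) holomorphic_on S" for S
      by (intro holomorphic_on_compose \<Phi>_hol holomorphic_intros)
    thus "k_Bessel_h k \<nu> c holomorphic_on ball 0 r" for r
      unfolding h by (intro holomorphic_intros) (simp add: o_def)
    show "z * deriv (k_Bessel_h k \<nu> c) z / k_Bessel_h k \<nu> c z =
        1 - of_real 1 * (of_real q * z ^ 1 * eval_fps neg_ld (of_real q * z ^ 1))"
      if z: "z \<noteq> 0" "ereal (q * norm z ^ 1) < neg_ld_radius" for z
    proof -
      have "(\<Phi> has_field_derivative - eval_fps neg_ld (of_real q * z) * \<Phi> (of_real q * z)) (at (of_real q * z))"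
        unfolding \<Phi>_def using z aq by (intro has_derivative_F) (simp add: norm_mult)
      hence "((\<lambda>z. \<Phi> (of_real q * z)) has_field_derivative
          - eval_fps neg_ld (of_real q * z) * \<Phi> (of_real q * z) * of_real q) (at z)"
        by (rule DERIV_chain2) (rule DERIV_cmult_Id)
      hence "deriv (k_Bessel_h k \<nu> c) z = 1 * \<Phi> (of_real q * z) +
          - eval_fps neg_ld (of_real q * z) * \<Phi> (of_real q * z) * of_real q * z"
        unfolding h by (intro DERIV_imp_deriv DERIV_mult DERIV_ident)
      thus ?thesis using z(1) nz2[OF z(2)] unfolding h
        by (simp add: field_simps)
    qed
    show "\<exists>N. N \<noteq> 0 \<and> of_real (sqrt r) * deriv W (of_real (sqrt r))
          - of_real (2 * (\<alpha> + \<nu> / (2 * k) - 1)) * W (of_real (sqrt r)) =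
        N * of_real (1 - \<alpha> - 1 * (q * r ^ 1 * neg_ld_real (q * r ^ 1)))"
      if r: "r > 0" "ereal (q * r ^ 1) < neg_ld_radius" for r
    proof -
      have r': "sqrt r > 0" "ereal (q * (sqrt r)\<^sup>2) < neg_ld_radius" using r by auto
      show ?thesis
        using W_nz[OF r'] r(1) unfolding dW[OF r']
        by (intro exI[of _ "2 * W (of_real (sqrt r))"]) (simp add: a_def algebra_simps)
    qed
  qed (use assms aq in auto)
  show ?thesis
    using A B C unfolding W_def by (rule conjI[OF _ conjI])
qed

end
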